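(* Let $n\ge 1$ and $1\le k\le n$. There is a bijection between the set of permutations $\pi\in S_n$ with $w(\pi)=0$ and exactly $k-1$ descents and the set of partitions of $\{1,\dots,n\}$ into $k$ (nonempty) blocks. In particular the number of such permutations is the Stirling number of the second kind $\left\{ n \atop k\right\}$.
   Context: For a word $\sigma$ of distinct positive integers, $\mathrm{des}(\sigma)$ is its number of descents (adjacent positions $i$ with $\sigma_i>\sigma_{i+1}$) and $\mathrm{st}(\sigma)$ is its standardization (replace the $j$-th smallest letter by $j$), a permutation. The weight $w\colon S_n\to\mathbb Z_{\ge0}$ is defined recursively: if $\pi$ is the identity $12\cdots n$ or the decreasing permutation $n(n-1)\cdots1$, then $w(\pi)=0$. Otherwise form the word $\pi(1)\cdots\pi(n)(n+1)$ and write it as $\pi_L\cdot 1\cdot\pi_R$, where $\pi_L$ is the (possibly empty) subword left of the letter $1$ and $\pi_R$ the subword right of $1$ (ending in $n+1$). Decompose $\pi_L=\pi_1\cdots\pi_l$: $\pi_1$ is the prefix of $\pi_L$ ending at its largest letter, $\pi_2$ the prefix of the remaining word ending at its largest letter, and so on. Then $w(\pi)=w(\mathrm{st}(\pi_R))+\mathrm{des}(\pi_R)+\sum_{i=1}^{l}\bigl(w(\mathrm{st}(\pi_i))+\mathrm{des}(\pi_i)\bigr)$. *)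

theory Defs
  imports "HOL-Combinatorics.Combinatorics"
begin

text \<open>
  Permutations of \<open>{1..n}\<close> are represented in one-line notation, i.e. as elements of
  \<open>permutations_of_set {1..n} :: nat list set\<close>.
\<close>

definition des :: "nat list \<Rightarrow> nat" where
  "des xs = card {i. Suc i < length xs \<and> xs ! i > xs ! Suc i}"

text \<open>For distinct letters, the number of letters \<open>y \<le> x\<close> is the \<open>j\<close> for which
  \<open>x\<close> is the \<open>j\<close>-th smallest letter.\<close>

definition st :: "nat list \<Rightarrow> nat list" where
  "st xs = map (\<lambda>x. card {y \<in> set xs. y \<le> x}) xs"

definition upto_letter :: "nat \<Rightarrow> nat list \<Rightarrow> nat list" where
  "upto_letter a xs = takeWhile (\<lambda>x. x \<noteq> a) xs @ [a]"

definition before_letter :: "nat \<Rightarrow> nat list \<Rightarrow> nat list" where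
  "before_letter a xs = takeWhile (\<lambda>x. x \<noteq> a) xs"

definition after_letter :: "nat \<Rightarrow> nat list \<Rightarrow> nat list" where
  "after_letter a xs = tl (dropWhile (\<lambda>x. x \<noteq> a) xs)"

lemma length_after_letter:
  "xs \<noteq> [] \<Longrightarrow> length (after_letter a xs) < length xs"
proof -
  assume "xs \<noteq> []"
  then have "0 < length xs" by simp
  then show ?thesis
    using length_dropWhile_le[of "\<lambda>x. x \<noteq> a" xs] unfolding after_letter_def length_tl by linarith
qed

function max_blocks :: "nat list \<Rightarrow> nat list list" where
  "max_blocks xs = (if xs = [] then [] else
     upto_letter (Max (set xs)) xs # max_blocks (after_letter (Max (set xs)) xs))"
  by pat_completeness auto
termination
  by (relation "measure length") (auto simp: length_after_letter)

declare max_blocks.simps [simp del]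

lemma set_takeWhile_dropWhile_after:
  "a \<in> set xs \<Longrightarrow> xs = before_letter a xs @ a # after_letter a xs"
  unfolding before_letter_def after_letter_def
  by (metis (mono_tags, lifting) dropWhile_eq_Nil_conv hd_dropWhile list.collapse
      takeWhile_dropWhile_id)

lemma max_blocks_length:
  "b \<in> set (max_blocks xs) \<Longrightarrow> length b \<le> length xs"
proof (induction xs rule: max_blocks.induct)
  case (1 xs)
  show ?case
  proof (cases "xs = []")
    case True
    then show ?thesis using 1 by (simp add: max_blocks.simps)
  next
    case False
    let ?m = "Max (set xs)"
    have "?m \<in> set xs" using False by simp
    then have "length xs = length (before_letter ?m xs @ ?m # after_letter ?m xs)"
      using set_takeWhile_dropWhile_after by metis
    then have "length (upto_letter ?m xs) \<le> length xs"
      by (simp add: upto_letter_def before_letter_def)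
    moreover have "b = upto_letter ?m xs \<or> b \<in> set (max_blocks (after_letter ?m xs))"
      using 1(2) False by (subst (asm) max_blocks.simps) auto
    ultimately show ?thesis
      using 1(1)[OF False] length_after_letter[OF False, of ?m] by force
  qed
qed

lemma length_st [simp]: "length (st xs) = length xs"
  by (simp add: st_def)

lemma st_less:
  assumes "i < length xs" "j < length xs" "xs ! i < xs ! j"
  shows "st xs ! i < st xs ! j"
proof -
  have "{y \<in> set xs. y \<le> xs ! i} \<subset> {y \<in> set xs. y \<le> xs ! j}"
    using assms nth_mem[of j xs] by force
  then show ?thesis
    using assms by (simp add: st_def psubset_card_mono)
qed

definition first_des :: "nat list \<Rightarrow> nat" where
  "first_des xs = (LEAST i. Suc i < length xs \<and> xs ! i > xs ! Suc i)"

lemma first_des_decreases: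
  assumes perm: "xs \<in> permutations_of_set {1..length xs}" and ne: "xs \<noteq> [1..<length xs + 1]"
    and one: "xs = 1 # ys"
  shows "first_des (st (ys @ [length xs + 1])) < first_des xs"
proof -
  have d: "distinct xs" and s: "set xs = {1..length xs}"
    using perm by (auto simp: permutations_of_set_def)
  have "\<not> sorted xs"
  proof
    assume "sorted xs"
    moreover have "set xs = set [1..<length xs + 1]"
      unfolding s by (simp only: set_upt) (simp add: atLeastLessThanSuc_atLeastAtMost)
    ultimately have "xs = [1..<length xs + 1]"
      using d sorted_upt distinct_upt by (rule_tac sorted_distinct_set_unique)
    with ne show False by simp
  qed
  then have "\<exists>i. Suc i < length xs \<and> xs ! i > xs ! Suc i"
    by (auto simp: sorted_iff_nth_Suc not_le)
  then have *: "Suc (first_des xs) < length xs \<and> xs ! first_des xs > xs ! Suc (first_des xs)"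
    unfolding first_des_def by (rule LeastI_ex)
  have "first_des xs \<noteq> 0"
  proof
    assume z: "first_des xs = 0"
    have "xs ! Suc 0 \<in> set xs" using * z by simp
    then show False using * z s one by auto
  qed
  then obtain e where e: "first_des xs = Suc e" by (cases "first_des xs") auto
  let ?r = "ys @ [length xs + 1]"
  have "Suc (Suc e) < length xs" "xs ! Suc e > xs ! Suc (Suc e)" using * e by auto
  then have "Suc e < length ?r" "?r ! e > ?r ! Suc e"
    using one by (auto simp: nth_append)
  then have "Suc e < length (st ?r) \<and> st ?r ! e > st ?r ! Suc e"
    using st_less[of "Suc e" ?r e] by simp
  then have "first_des (st ?r) \<le> e"
    unfolding first_des_def by (rule Least_le)
  then show ?thesis using e by simp
qed

text \<open>
  The weight is only meaningful for permutations of \<open>{1..n}\<close> in one-line notation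
  (a class closed under the recursive calls); every other list gets the dummy value \<open>0\<close>.
  The recursion may keep the length (when \<open>xs\<close> starts with \<open>1\<close>), but then the first descent
  moves to the left.
\<close>

function weight :: "nat list \<Rightarrow> nat" where
  "weight xs = (let n = length xs in
     if xs \<notin> permutations_of_set {1..n} \<or> xs = [1..<n+1] \<or> xs = rev [1..<n+1] then 0
     else let word = xs @ [n+1];
              L = before_letter 1 word;
              R = after_letter 1 word
          in (weight (st R) + des R) + (\<Sum>b\<leftarrow>max_blocks L. weight (st b) + des b))"
  by pat_completeness auto
termination
proof (relation "measures [length, first_des]", goal_cases)
  case 1
  then show ?case by simp
next
  case (2 xs n word L R)
  then have perm: "xs \<in> permutations_of_set {1..length xs}" and ne: "xs \<noteq> [1..<length xs + 1]"
    by auto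
  have "xs \<noteq> []" using ne by auto
  then have "1 \<in> set xs"
    using perm by (cases xs) (auto simp: permutations_of_set_def)
  then have w: "word = L @ 1 # R"
    using 2 set_takeWhile_dropWhile_after[of 1 word] by auto
  then have len: "length xs = length L + length R"
    using 2 by (metis add_Suc_right length_Cons length_append length_append_singleton nat.inject)
  show ?case
  proof (cases L)
    case Nil
    obtain y ys where y: "xs = y # ys" using \<open>xs \<noteq> []\<close> by (cases xs) auto
    then have "y = 1" "R = ys @ [length xs + 1]" using w Nil 2 by auto
    then show ?thesis
      using first_des_decreases[OF perm ne, of ys] y len Nil by simp
  next
    case (Cons a l)
    then show ?thesis using len by simp
  qed
next
  case (3 xs n word L R b)
  then have perm: "xs \<in> permutations_of_set {1..length xs}" and ne: "xs \<noteq> [1..<length xs + 1]"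
    by auto
  have "xs \<noteq> []" using ne by auto
  then have one: "1 \<in> set xs"
    using perm by (cases xs) (auto simp: permutations_of_set_def)
  then have L: "L = before_letter 1 xs"
    using 3 by (auto simp: before_letter_def)
  then have "xs = L @ 1 # after_letter 1 xs"
    using one set_takeWhile_dropWhile_after by metis
  then have "length L < length xs"
    by (metis add_Suc_right length_Cons length_append less_add_Suc1)
  then show ?case
    using max_blocks_length[of b L] 3 by simp
qed

declare weight.simps [simp del]

end

theory Submission
  imports Defs
begin

text \<open>
  A permutation \<open>L @ 1 # R\<close> has weight zero iff \<open>R\<close> and all blocks of \<open>max_blocks L\<close> are
  increasing. The letters of the blocks of \<open>L\<close>, together with the letters of \<open>1 # R\<close>, then form a
  set partition, and every descent is a passage from one block to the next. Conversely the
  permutation is recovered from the partition: the block containing \<open>1\<close> comes last, the other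
  ones are ordered by decreasing maximum, and each block is written increasingly.
\<close>

section \<open>Counting set partitions\<close>

lemma partition_on_insert_singleton:
  assumes "a \<notin> A" "partition_on A P"
  shows "partition_on (insert a A) (insert {a} P)"
  using assms by (auto simp: partition_on_def pairwise_insert disjnt_iff)

lemma partition_on_insert_into_block:
  assumes "a \<notin> A" "partition_on A P" "B \<in> P"
  shows "partition_on (insert a A) (insert (insert a B) (P - {B}))"
  using assms by (auto simp: partition_on_def pairwise_def disjnt_def)

lemma partition_on_remove_block:
  assumes "partition_on A P" "B \<in> P"
  shows "partition_on (A - B) (P - {B})"
  using assms by (auto simp: partition_on_def pairwise_def disjnt_def)

lemma partition_on_eq_block:
  assumes "partition_on A P" "B \<in> P" "C \<in> P" "x \<in> B" "x \<in> C"
  shows "B = C"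
  using assms by (auto simp: partition_on_def pairwise_def disjnt_def)

text \<open>Either \<open>a\<close> forms a block by itself, or deleting it leaves a partition of
  \<open>A\<close> with equally many blocks; the pair \<open>(P, B)\<close> records which block of
  \<open>P\<close> it had joined. This is the Stirling recurrence before counting.\<close>

lemma partitions_insert_eq:
  assumes fin: "finite A" and a: "a \<notin> A"
  shows "{Q. partition_on (insert a A) Q \<and> card Q = Suc k} =
    insert {a} ` {P. partition_on A P \<and> card P = k} \<union>
    (\<lambda>(P, B). insert (insert a B) (P - {B})) ` (SIGMA P:{P. partition_on A P \<and> card P = Suc k}. P)"
    (is "?Q = ?S \<union> ?T")
proof (intro equalityI subsetI)
  fix Q assume "Q \<in> ?Q"
  then have Q: "partition_on (insert a A) Q" and c: "card Q = Suc k" by auto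
  have finQ: "finite Q" using Q fin by (meson finite.insertI finite_elements)
  from Q obtain C where C: "C \<in> Q" "a \<in> C" by (auto simp: partition_on_def)
  have rest: "partition_on (insert a A - C) (Q - {C})"
    using Q C(1) by (rule partition_on_remove_block)
  have Csub: "C \<subseteq> insert a A" using Q C by (auto simp: partition_on_def)
  show "Q \<in> ?S \<union> ?T"
  proof (cases "C = {a}")
    case True
    then have "partition_on A (Q - {C})" using rest a by simp
    moreover have "card (Q - {C}) = k" using c C finQ by simp
    moreover have "Q = insert {a} (Q - {C})" using C True by auto
    ultimately show ?thesis by blast
  next
    case False
    define B where "B = C - {a}"
    have B: "B \<noteq> {}" "B \<subseteq> A" "C = insert a B" "a \<notin> B"
      using False C(2) Csub by (auto simp: B_def)
    have dB: "disjnt B (\<Union>(Q - {C}))"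
      using Q C(1) by (auto simp: partition_on_def pairwise_def disjnt_def B_def)
    have "A - B = insert a A - C" using B a by auto
    then have P: "partition_on A (insert B (Q - {C}))"
      using rest B dB by (simp add: partition_on_insert)
    \<comment> \<open>\<open>B\<close> is nonempty and disjoint from the other blocks, so putting it
      back restores the block count, and deleting it afterwards gives back
      \<open>Q - {C}\<close>.\<close>
    have Bn: "B \<notin> Q - {C}" using dB B(1) by (auto simp: disjnt_def)
    have "card (insert B (Q - {C})) = Suc k" using c C finQ Bn by simp
    moreover have "Q = insert (insert a B) (insert B (Q - {C}) - {B})"
      using Bn B C by auto
    ultimately show ?thesis using P by (intro UnI2 image_eqI[of _ _ "(insert B (Q - {C}), B)"]) auto
  qed
next
  fix Q assume "Q \<in> ?S \<union> ?T"
  then show "Q \<in> ?Q"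
  proof
    assume "Q \<in> ?S"
    then obtain P where P: "partition_on A P" "card P = k" "Q = insert {a} P" by auto
    have "{a} \<notin> P" using P(1) a by (auto simp: partition_on_def)
    moreover have "finite P" using fin P(1) by (rule finite_elements)
    ultimately show ?thesis using P partition_on_insert_singleton[OF a P(1)] by simp
  next
    assume "Q \<in> ?T"
    then obtain P B where P: "partition_on A P" "card P = Suc k" "B \<in> P"
      "Q = insert (insert a B) (P - {B})" by auto
    have "insert a B \<notin> P" using P(1) a by (auto simp: partition_on_def)
    moreover have "finite P" using fin P(1) by (rule finite_elements)
    ultimately show ?thesis using P partition_on_insert_into_block[OF a P(1,3)] by simp
  qed
qed

text \<open>Induction along \<open>Stirling (Suc n) (Suc j) = Stirling n j + Suc j * Stirling n (Suc
  j)\<close>: the new point is alone, or it joins one of the \<open>Suc j\<close> blocks of a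
  partition of \<open>A\<close>.\<close>

lemma card_partitions_eq_Stirling:
  assumes "finite A"
  shows "card {P. partition_on A P \<and> card P = k} = Stirling (card A) k"
  using assms
proof (induction A arbitrary: k rule: finite_induct)
  case empty
  then show ?case
    by (cases k) (auto simp: partition_on_empty Collect_conv_if)
next
  case (insert a A)
  let ?part = "\<lambda>k. {P. partition_on A P \<and> card P = k}"
  let ?f = "\<lambda>(P, B). insert (insert a B) (P - {B})"
  have finP: "finite (?part j)" for j
    using finitely_many_partition_on[OF insert(1)] by (rule rev_finite_subset) auto
  show ?case
  proof (cases k)
    case 0
    have "card P \<noteq> 0" if "partition_on (insert a A) P" for P
    proof -
      have "finite P" using insert(1) that by (meson finite.insertI finite_elements)
      moreover have "P \<noteq> {}" using that by (auto simp: partition_on_def)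
      ultimately show ?thesis by simp
    qed
    then have "{P. partition_on (insert a A) P \<and> card P = k} = {}" using 0 by auto
    then show ?thesis using 0 insert(1,2) by (simp only: card.empty) simp
  next
    case (Suc j)
    have notin: "a \<notin> X" if "partition_on A P" "X \<in> P" for P X
      using that insert(2) by (auto simp: partition_on_def)
    have inj1: "inj_on (insert {a}) (?part j)"
    proof (rule inj_onI)
      fix P P' assume "P \<in> ?part j" "P' \<in> ?part j" and eq: "insert {a} P = insert {a} P'"
      then have "{a} \<notin> P" "{a} \<notin> P'" using notin by auto
      with eq show "P = P'" by (rule insert_ident[THEN iffD1, rotated -1])
    qed
    \<comment> \<open>The image has \<open>insert a B\<close> as its only block containing
      \<open>a\<close>, so it reveals \<open>B\<close>; replacing that block by \<open>B\<close>
      recovers \<open>P\<close>.\<close>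
    have inj2: "inj_on ?f (SIGMA P:?part (Suc j). P)"
    proof (rule inj_onI, clarify)
      fix P B P' B'
      assume P: "partition_on A P" "B \<in> P" and P': "partition_on A P'" "B' \<in> P'"
        and eq: "insert (insert a B) (P - {B}) = insert (insert a B') (P' - {B'})"
      have "insert a B \<notin> P" "insert a B' \<notin> P" "insert a B \<notin> P'" "insert a B' \<notin> P'"
        using notin P P' by blast+
      then have C: "insert a B = insert a B'" using eq by blast
      then have B: "B = B'" using notin[OF P] notin[OF P'] by (meson insert_ident)
      have "P - {B} = P' - {B'}"
        using eq C \<open>insert a B \<notin> P\<close> \<open>insert a B' \<notin> P'\<close> by (metis DiffD1 insert_ident)
      then show "P = P' \<and> B = B'" using B P P' by blast
    qed
    \<comment> \<open>Blocks of a partition are nonempty, so the block containing \<open>a\<close>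
      is a singleton in the first image and never in the second.\<close>
    have disj: "insert {a} ` ?part j \<inter> ?f ` (SIGMA P:?part (Suc j). P) = {}"
    proof -
      have False if P: "partition_on A P" and P': "partition_on A P'" "B \<in> P'"
        and eq: "insert {a} P = insert (insert a B) (P' - {B})" for P P' B
      proof -
        have "B \<noteq> {}" "a \<notin> B" using notin P' by (auto simp: partition_on_def)
        then have "{a} \<noteq> insert a B" by blast
        moreover have "{a} \<notin> P'" using notin P' by blast
        ultimately show False using eq by blast
      qed
      then show ?thesis by fastforce
    qed
    have fin2: "finite (SIGMA P:?part (Suc j). P)"
      using finP insert(1) by (intro finite_SigmaI) (auto intro: finite_elements)
    have "card (SIGMA P:?part (Suc j). P) = (\<Sum>P\<in>?part (Suc j). card P)"
      using finP insert(1) by (intro card_SigmaI) (auto intro: finite_elements)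
    also have "\<dots> = Suc j * card (?part (Suc j))" by simp
    finally have "card {P. partition_on (insert a A) P \<and> card P = Suc j} =
        card (?part j) + Suc j * card (?part (Suc j))"
      using finP fin2
      by (simp add: partitions_insert_eq[OF insert(1,2)] card_Un_disjoint disj
          card_image[OF inj1] card_image[OF inj2])
    then show ?thesis using Suc insert by simp
  qed
qed

section \<open>Descents and standardization\<close>

lemma des_Nil [simp]: "des [] = 0"
  and des_singleton [simp]: "des [x] = 0"
  by (simp_all add: des_def)

text \<open>Position 0 is split off and the other positions are shifted by \<open>Suc\<close>; this
  turns the count of indices into a recursion fit for list induction.\<close>

lemma des_Cons_Cons [simp]: "des (x # y # zs) = (if y < x then 1 else 0) + des (y # zs)"
proof -
  let ?D = "{i. Suc i < length (y # zs) \<and> (y # zs) ! i > (y # zs) ! Suc i}"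
  have "{i. Suc i < length (x # y # zs) \<and> (x # y # zs) ! i > (x # y # zs) ! Suc i} =
      {i. i = 0 \<and> y < x} \<union> Suc ` ?D" (is "?l = ?Z \<union> _")
  proof (rule set_eqI)
    show "i \<in> ?l \<longleftrightarrow> i \<in> ?Z \<union> Suc ` ?D" for i by (cases i) auto
  qed
  moreover have "finite ?D" "finite ?Z" by auto
  ultimately have "des (x # y # zs) = card ?Z + card (Suc ` ?D)"
    unfolding des_def by (simp only:) (intro card_Un_disjoint; auto)
  then show ?thesis by (auto simp: des_def card_image)
qed

lemma des_eq_0_iff: "des xs = 0 \<longleftrightarrow> sorted xs"
  by (induction xs rule: induct_list012) (simp_all add: sorted2 sorted_wrt1 del: sorted_wrt.simps(2))

text \<open>The increasing word \<open>u\<close> has no descent inside, so only the junction between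
  \<open>last u\<close> and \<open>y\<close> adds one.\<close>

lemma des_sorted_append:
  assumes "sorted u" "u \<noteq> []" "y < last u"
  shows "des (u @ y # v) = Suc (des (y # v))"
  using assms by (induction u rule: induct_list012) auto

text \<open>In a strictly increasing word the letters not exceeding the one at index
  \<open>i\<close> are those at indices 0 to \<open>i\<close>, so there are \<open>Suc i\<close> of
  them. An increasing block thus standardizes to an identity, whose weight is 0.\<close>

lemma st_sorted:
  assumes "sorted xs" "distinct xs"
  shows "st xs = [1..<length xs + 1]"
proof (rule nth_equalityI)
  fix i assume i: "i < length (st xs)"
  have strict: "sorted_wrt (<) xs" using assms by (simp add: strict_sorted_iff)
  have mono: "xs ! j \<le> xs ! i \<longleftrightarrow> j \<le> i" if "j < length xs" for j
    using sorted_wrt_nth_less[OF strict, of i j] sorted_nth_mono[OF assms(1), of j i] i that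
    by (cases "j \<le> i") auto
  have "{y \<in> set xs. y \<le> xs ! i} = (!) xs ` {..i}"
    proof (intro equalityI subsetI)
    show "y \<in> (!) xs ` {..i}" if "y \<in> {y \<in> set xs. y \<le> xs ! i}" for y
      using that mono by (auto simp: in_set_conv_nth)
    show "y \<in> {y \<in> set xs. y \<le> xs ! i}" if "y \<in> (!) xs ` {..i}" for y
      using that mono i by auto
  qed
  also have "card \<dots> = Suc i"
    using assms i by (subst card_image) (auto simp: inj_on_def nth_eq_iff_index_eq)
  finally show "st xs ! i = [1..<length xs + 1] ! i" using i by (simp add: st_def del: upt_Suc)
qed (simp del: upt_Suc)

lemma weight_upt [simp]: "weight [1..<n + 1] = 0"
  by (subst weight.simps) (simp add: Let_def del: upt_Suc)

section \<open>The block decomposition\<close>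

lemma max_blocks_Nil [simp]: "max_blocks [] = []"
  by (simp add: max_blocks.simps)

text \<open>One unfolding of the recursion with the maximum exposed; strictness makes
  \<open>m\<close> occur only once, so cutting at its first occurrence yields exactly
  \<open>u\<close> and \<open>v\<close>.\<close>

lemma max_blocks_append:
  assumes "\<forall>x\<in>set u \<union> set v. x < m"
  shows "max_blocks (u @ m # v) = (u @ [m]) # max_blocks v"
proof -
  have max: "Max (set (u @ m # v)) = m"
    using assms by (intro Max_eqI) (auto simp: less_imp_le)
  have "m \<notin> set u" using assms by blast
  then have "takeWhile (\<lambda>x. x \<noteq> m) (u @ m # v) = u" "dropWhile (\<lambda>x. x \<noteq> m) (u @ m # v) = m # v"
    by (auto simp: takeWhile_append dropWhile_append)
  then show ?thesis
    by (subst max_blocks.simps) (simp only: max upto_letter_def after_letter_def, simp)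
qed

lemma distinct_Max_split:
  fixes L :: "'a :: linorder list"
  assumes "distinct L" "L \<noteq> []"
  obtains u m v where "L = u @ m # v" "\<forall>x\<in>set u \<union> set v. x < m"
proof -
  obtain u v where uv: "L = u @ Max (set L) # v"
    using assms(2) by (metis List.finite_set Max_in set_empty split_list)
  have "x < Max (set L)" if "x \<in> set u \<union> set v" for x
  proof -
    have "x \<in> set L" using that by (subst uv) auto
    moreover have "x \<noteq> Max (set L)" using that assms(1) by (subst (asm) uv) auto
    ultimately show ?thesis by (metis List.finite_set Max_ge order_le_imp_less_or_eq)
  qed
  with uv show thesis using that by blast
qed

text \<open>Mirrors the recursion of \<open>max_blocks\<close>: cut at the maximum and continue with
  the right part only. Each induction step can then be evaluated by
  \<open>max_blocks_append\<close>.\<close>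

lemma max_split_induct [consumes 1, case_names Nil split]:
  fixes L :: "'a :: linorder list"
  assumes "distinct L"
    and "P []"
    and "\<And>u m v. distinct (u @ m # v) \<Longrightarrow> (\<forall>x\<in>set u \<union> set v. x < m) \<Longrightarrow>
      P v \<Longrightarrow> P (u @ m # v)"
  shows "P L"
  using assms(1)
proof (induction L rule: length_induct)
  case (1 L)
  show ?case
  proof (cases "L = []")
    case False
    obtain u m v where L: "L = u @ m # v" "\<forall>x\<in>set u \<union> set v. x < m"
      using distinct_Max_split[OF 1(2) False] by metis
    with 1 have "P v" by auto
    then show ?thesis using assms(3) 1(2) L by simp
  qed (simp add: assms)
qed

lemma concat_max_blocks:
  assumes "distinct L"
  shows "concat (max_blocks L) = L"
  using assms by (induction rule: max_split_induct) (simp_all add: max_blocks_append)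

text \<open>The blocks are nonempty with pairwise disjoint letters, so passing from words to letter
  sets merges no two of them. The count links the number of set blocks to the number of
  descents.\<close>

lemma partition_on_max_blocks:
  assumes "distinct L"
  shows "partition_on (set L) (set ` set (max_blocks L)) \<and>
    card (set ` set (max_blocks L)) = length (max_blocks L)"
  using assms
proof (induction rule: max_split_induct)
  case Nil
  then show ?case by (simp add: partition_on_empty)
next
  case (split u m v)
  let ?B = "insert m (set u)" and ?P = "set ` set (max_blocks v)"
  have U: "\<Union>?P = set v" using split(3) by (auto simp: partition_on_def)
  have d: "disjnt ?B (\<Union>?P)" unfolding U using split(1) by (auto simp: disjnt_def)
  then have "?B \<notin> ?P" by (auto simp: disjnt_def)
  moreover have "set (u @ m # v) - ?B = set v" using split(1) by auto
  ultimately show ?case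
    using split(3) d by (simp add: max_blocks_append[OF split(2)] partition_on_insert subset_insertI2)
qed

text \<open>In a decreasing word each letter is the maximum of what remains, so every block is a
  single letter. This serves the decreasing permutation, whose weight is 0 by convention.\<close>

lemma sorted_max_blocks_if_decreasing:
  assumes "sorted_wrt (>) L" "b \<in> set (max_blocks L)"
  shows "sorted b"
  using assms
proof (induction L)
  case (Cons x L)
  then show ?case using max_blocks_append[of "[]" L x] by auto
qed simp

text \<open>Each increasing block ends at the maximum of the rest of \<open>L\<close>, so the letter
  after it is smaller: every block causes one descent, at its end, and \<open>a # R\<close> causes
  none.\<close>

lemma des_blocks:
  assumes "distinct L" "\<forall>b\<in>set (max_blocks L). sorted b" "\<forall>x\<in>set L. a < x" "sorted (a # R)"
  shows "des (L @ a # R) = length (max_blocks L)"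
  using assms
proof (induction rule: max_split_induct)
  case Nil
  then show ?case using des_eq_0_iff[of "a # R"] by simp
next
  case (split u m v)
  have IH: "des (v @ a # R) = length (max_blocks v)"
    using split by (simp add: max_blocks_append)
  \<comment> \<open>The letter \<open>y\<close> after the first block is the first letter of
    \<open>v\<close>, or \<open>a\<close> if \<open>v\<close> is empty; both lie below
    \<open>m\<close>.\<close>
  obtain y w where yw: "v @ a # R = y # w" by (cases "v @ a # R") auto
  then have "y = a \<or> y \<in> set v" by (cases v) auto
  then have "y < m" using split by auto
  moreover have "sorted (u @ [m])" using split by (simp add: max_blocks_append[OF split(2)])
  ultimately have "des ((u @ [m]) @ y # w) = Suc (des (y # w))"
    by (intro des_sorted_append) auto
  then show ?case using IH yw by (simp add: max_blocks_append[OF split(2)])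
qed

text \<open>Strong induction on \<open>card A\<close>. The first block of a word ends at its overall
  maximum, so the part containing \<open>Max A\<close> must come first, and sortedness fixes its
  spelling. The other parts determine the remaining word by induction.\<close>

lemma ex1_word_of_partition:
  assumes "finite A" "partition_on A P"
  shows "\<exists>!L. distinct L \<and> set L = A \<and> (\<forall>b\<in>set (max_blocks L). sorted b) \<and>
    set ` set (max_blocks L) = P"
  using assms
proof (induction "card A" arbitrary: A P rule: less_induct)
  case less
  show ?case
  proof (cases "A = {}")
    case True
    then show ?thesis using less(3) by (auto simp: partition_on_empty)
  next
    case False
    define m where "m = Max A"
    have m: "m \<in> A" "\<And>x. x \<in> A \<Longrightarrow> x \<le> m" using False less(2) by (auto simp: m_def)
    obtain B where B: "B \<in> P" "m \<in> B" using m less(3) by (auto simp: partition_on_def)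
    have BA: "B \<subseteq> A" using B less(3) by (auto simp: partition_on_def)
    have finB: "finite B" using BA less(2) by (rule finite_subset)
    let ?good = "\<lambda>L A P. distinct L \<and> set L = A \<and> (\<forall>b\<in>set (max_blocks L). sorted b) \<and>
      set ` set (max_blocks L) = P"
    define good where "good L \<longleftrightarrow> ?good L (A - B) (P - {B})" for L
    have "card (A - B) < card A" using B BA less(2) by (intro psubset_card_mono) auto
    then have ex1: "\<exists>!L. good L"
      unfolding good_def
      using less(1)[of "A - B" "P - {B}"] less(2) partition_on_remove_block[OF less(3) B(1)] by auto
    then obtain L' where "good L'" by blast
    then have L': "?good L' (A - B) (P - {B})" unfolding good_def .
    define u where "u = sorted_list_of_set (B - {m})"
    have setu: "set u = B - {m}" "distinct u" "sorted u"
      using finB by (simp_all add: u_def)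
    have sortu: "sorted (u @ [m])" using setu BA m(2) by (auto simp: sorted_append)
    have um: "sorted_list_of_set B = u @ [m]"
    proof (rule sorted_distinct_set_unique)
      show "set (sorted_list_of_set B) = set (u @ [m])" using finB setu(1) B(2) by auto
      show "distinct (u @ [m])" using setu by simp
    qed (use sortu in simp_all)
    have lt: "\<forall>x\<in>set u \<union> set L'. x < m"
    proof
      fix x assume that: "x \<in> set u \<union> set L'"
      have "x \<in> A" "x \<noteq> m" using that setu L' B BA by auto
      then show "x < m" using m(2)[of x] by simp
    qed
    show ?thesis
    proof (rule ex1I[of _ "u @ m # L'"])
      have "distinct (u @ m # L')" "set (u @ m # L') = A"
        using setu L' B BA by auto
      moreover have "set (u @ [m]) = B" using setu B by auto
      then have "set ` set (max_blocks (u @ m # L')) = insert B (P - {B})"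
        using max_blocks_append[OF lt] L' by simp
      ultimately show "?good (u @ m # L') A P"
        using max_blocks_append[OF lt] sortu L' B by (auto simp: insert_absorb)
    next
      fix L assume L: "?good L A P"
      then have "L \<noteq> []" using False by auto
      then obtain u' m' v where s: "L = u' @ m' # v" "\<forall>x\<in>set u' \<union> set v. x < m'"
        using distinct_Max_split L by metis
      have "m' = m"
      proof (rule antisym)
        show "m' \<le> m" using m(2) L s(1) by auto
        show "m \<le> m'" using m(1) L s by (auto simp: less_imp_le)
      qed
      have mb: "max_blocks L = (u' @ [m']) # max_blocks v"
        using max_blocks_append[OF s(2)] s(1) by simp
      then have "set (u' @ [m']) \<in> P" "m \<in> set (u' @ [m'])"
        using L \<open>m' = m\<close> by auto
      then have B': "set (u' @ [m']) = B" using partition_on_eq_block[OF less(3)] B by blast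
      have "sorted (u' @ [m'])" "distinct (u' @ [m'])" using L mb s by auto
      \<comment> \<open>A finite set has only one increasing listing, so the first block of any
        solution is spelled like that of the constructed one.\<close>
      then have u': "u' @ [m'] = u @ [m]"
        using B' um finB by (metis sorted_list_of_set.idem_if_sorted_distinct)
      have dv: "distinct v" "set v = A - B" using L s B' by auto
      \<comment> \<open>The blocks of \<open>v\<close> lie inside \<open>A - B\<close>, while
        \<open>m\<close> belongs to \<open>B\<close>. Hence removing \<open>B\<close> from
        \<open>P\<close> leaves precisely the blocks of \<open>v\<close>.\<close>
      have "B \<notin> set ` set (max_blocks v)"
        using partition_on_max_blocks[OF dv(1)] dv(2) B BA by (auto simp: partition_on_def)
      moreover have "insert B (set ` set (max_blocks v)) = P" using L mb B' by auto
      ultimately have "good v" unfolding good_def using L mb dv by auto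
      then have "v = L'" using ex1 \<open>good L'\<close> by blast
      then show "L = u @ m # L'" using u' s by simp
    qed
  qed
qed

section \<open>Permutations of weight zero\<close>

lemma before_letter_append [simp]:
  "a \<notin> set L \<Longrightarrow> before_letter a (L @ a # R) = L"
  by (auto simp: before_letter_def takeWhile_append)

lemma after_letter_append [simp]:
  "a \<notin> set L \<Longrightarrow> after_letter a (L @ a # R) = R"
  by (auto simp: after_letter_def dropWhile_append)

text \<open>A sum of naturals vanishes iff each term does; a vanishing \<open>des\<close> forces
  sortedness, and sorted words standardize to identities of weight 0. The two permutations of weight
  0 by convention are checked separately.\<close>

lemma weight_eq_0_iff:
  assumes perm: "L @ 1 # R \<in> permutations_of_set {1..n}"
  shows "weight (L @ 1 # R) = 0 \<longleftrightarrow> (\<forall>b\<in>set (max_blocks L). sorted b) \<and> sorted R"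
proof -
  let ?xs = "L @ 1 # R"
  have d: "distinct ?xs" and s: "set ?xs = {1..n}" using perm by (auto simp: permutations_of_set_def)
  have len: "length ?xs = n" using distinct_card[OF d] s by simp
  have notin: "1 \<notin> set L" using d by auto
  have sub: "set b \<subseteq> set L \<and> distinct b" if "b \<in> set (max_blocks L)" for b
  proof -
    have "distinct (concat (max_blocks L))" "set (concat (max_blocks L)) = set L"
      using d by (simp_all add: concat_max_blocks)
    then show ?thesis using that by (auto simp: distinct_concat_iff)
  qed
  \<comment> \<open>The appended letter \<open>n + 1\<close> exceeds all others, so it affects
    neither sortedness nor distinctness.\<close>
  have Rn: "sorted (R @ [n + 1]) \<longleftrightarrow> sorted R" "distinct (R @ [n + 1])"
  proof -
    have "set R \<subseteq> {1..n}" using s by auto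
    then show "sorted (R @ [n + 1]) \<longleftrightarrow> sorted R" "distinct (R @ [n + 1])"
      using d by (auto simp: sorted_append)
  qed
  have zero: "weight (st b) + des b = 0 \<longleftrightarrow> sorted b" if "distinct b" for b
    using that st_sorted[of b] weight_upt[of "length b"] des_eq_0_iff[of b] by auto
  consider (id) "?xs = [1..<n + 1]" | (rev) "?xs = rev [1..<n + 1]"
    | (other) "?xs \<noteq> [1..<n + 1]" "?xs \<noteq> rev [1..<n + 1]" by blast
  then show ?thesis
  proof cases
    case id
    then have srt: "sorted ?xs" by (simp del: upt_Suc)
    \<comment> \<open>In the identity the least letter 1 comes first, so there are no blocks to its
      left.\<close>
    have "L = []"
    proof (rule ccontr)
      assume "L \<noteq> []"
      then obtain x where x: "x \<in> set L" by (meson list.set_sel(1))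
      then have "x \<le> 1" using srt by (auto simp: sorted_append)
      moreover have "1 \<le> x" using x s by auto
      ultimately show False using x notin by simp
    qed
    then show ?thesis using srt id weight_upt[of n] by auto
  next
    case rev
    have "sorted_wrt (>) (rev [1..<n + 1])" by (simp add: sorted_wrt_rev del: upt_Suc)
    then have dec: "sorted_wrt (>) ?xs" using rev by simp
    \<comment> \<open>In the decreasing permutation 1 comes last, so only the single-letter blocks
      of \<open>L\<close> remain.\<close>
    have "R = []"
    proof (rule ccontr)
      assume "R \<noteq> []"
      then obtain x where x: "x \<in> set R" by (meson list.set_sel(1))
      then have "x < 1" using dec by (auto simp: sorted_wrt_append)
      moreover have "1 \<le> x" using x s by auto
      ultimately show False by simp
    qed
    moreover have "sorted_wrt (>) L" using dec by (simp add: sorted_wrt_append)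
    moreover have "weight ?xs = 0" using rev len by (subst weight.simps) (simp add: Let_def)
    ultimately show ?thesis using sorted_max_blocks_if_decreasing by auto
  next
    case other
    have "weight ?xs = (weight (st (R @ [n + 1])) + des (R @ [n + 1])) +
        (\<Sum>b\<leftarrow>max_blocks L. weight (st b) + des b)"
      using other perm len notin by (subst weight.simps) (simp add: Let_def del: upt_Suc)
    then show ?thesis using zero[OF Rn(2)] Rn(1) zero sub by (auto simp: sum_list_eq_0_iff)
  qed
qed

text \<open>The letter after which \<open>weight\<close> cuts joins the right part, so 1 has a block
  too. The cut is made in \<open>xs\<close> itself, without the appended \<open>n + 1\<close>, so
  all letters stay in \<open>{1..n}\<close>.\<close>

definition blocks_of_perm :: "nat list \<Rightarrow> nat set set" where
  "blocks_of_perm xs =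
     insert (set (1 # after_letter 1 xs)) (set ` set (max_blocks (before_letter 1 xs)))"

text \<open>By \<open>des_blocks\<close> with \<open>a = 1\<close>, descents correspond to the
  blocks left of 1; the block of 1 accounts for the \<open>Suc\<close>.\<close>

lemma weight_0_perm:
  assumes "n \<ge> 1" "xs \<in> permutations_of_set {1..n}" "weight xs = 0"
  shows "partition_on {1..n} (blocks_of_perm xs) \<and> card (blocks_of_perm xs) = Suc (des xs)"
proof -
  have d: "distinct xs" and s: "set xs = {1..n}"
    using assms(2) by (auto simp: permutations_of_set_def)
  have "1 \<in> set xs" using s assms(1) by simp
  then obtain L R where xs: "xs = L @ 1 # R" by (meson split_list)
  have notin: "1 \<notin> set L" using d xs by auto
  have srt: "\<forall>b\<in>set (max_blocks L). sorted b" "sorted R"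
    using weight_eq_0_iff assms(2,3) xs by auto
  have ge: "x \<ge> 1" if "x \<in> set xs" for x using that s by auto
  have dL: "distinct L" using d xs by auto
  let ?B = "insert 1 (set R)" and ?P = "set ` set (max_blocks L)"
  have P: "partition_on (set L) ?P" "card ?P = length (max_blocks L)"
    using partition_on_max_blocks[OF dL] by auto
  have U: "\<Union>?P = set L" using P by (auto simp: partition_on_def)
  have disj: "disjnt ?B (\<Union>?P)" unfolding U using d xs by (auto simp: disjnt_def)
  then have "?B \<notin> ?P" by (auto simp: disjnt_def)
  moreover have "{1..n} - ?B = set L" using s d xs by auto
  moreover have "?B \<subseteq> {1..n}" using s xs by auto
  moreover have "des xs = length (max_blocks L)"
    unfolding xs
  proof (rule des_blocks[OF dL srt(1)])
    show "\<forall>x\<in>set L. 1 < x"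
      using ge notin xs by (metis Un_iff le_neq_implies_less set_append)
    show "sorted (1 # R)" using ge srt(2) xs by auto
  qed
  ultimately show ?thesis
    using P disj xs notin by (simp add: blocks_of_perm_def partition_on_insert)
qed

text \<open>The part containing 1 must be \<open>1 # R\<close> with \<open>R\<close> increasing,
  which fixes \<open>R\<close>; the other parts fix \<open>L\<close> by
  \<open>ex1_word_of_partition\<close>. Existence gives surjectivity of
  \<open>blocks_of_perm\<close>, uniqueness its injectivity.\<close>

lemma ex1_perm_of_partition:
  assumes "n \<ge> 1" "partition_on {1..n} P"
  shows "\<exists>!xs. xs \<in> permutations_of_set {1..n} \<and> weight xs = 0 \<and> blocks_of_perm xs = P"
proof -
  have "1 \<in> \<Union>P" using partition_onD1[OF assms(2), symmetric] assms(1) by simp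
  then obtain B where B: "B \<in> P" "1 \<in> B" by blast
  have BA: "B \<subseteq> {1..n}" using B assms(2) by (auto simp: partition_on_def)
  have finB: "finite B" using BA by (rule finite_subset) simp
  define good where "good L \<longleftrightarrow> distinct L \<and> set L = {1..n} - B \<and>
    (\<forall>b\<in>set (max_blocks L). sorted b) \<and> set ` set (max_blocks L) = P - {B}" for L
  have ex1: "\<exists>!L. good L"
    unfolding good_def using partition_on_remove_block[OF assms(2) B(1)] by (intro ex1_word_of_partition) auto
  then obtain L where "good L" by blast
  then have L: "distinct L" "set L = {1..n} - B" "\<forall>b\<in>set (max_blocks L). sorted b"
    "set ` set (max_blocks L) = P - {B}" unfolding good_def by blast+
  define R where "R = sorted_list_of_set (B - {1})"
  have R: "set R = B - {1}" "distinct R" "sorted R" using finB by (auto simp: R_def)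
  show ?thesis
  proof (rule ex1I[of _ "L @ 1 # R"])
    have perm: "L @ 1 # R \<in> permutations_of_set {1..n}"
      using L R B BA by (auto simp: permutations_of_set_def)
    moreover have "1 \<notin> set L" using L B by auto
    moreover have "insert 1 (set R) = B" using R B by auto
    ultimately show "L @ 1 # R \<in> permutations_of_set {1..n} \<and> weight (L @ 1 # R) = 0 \<and>
        blocks_of_perm (L @ 1 # R) = P"
      using weight_eq_0_iff[OF perm] L R(3) B(1) by (auto simp: blocks_of_perm_def)
  next
    fix xs assume xs: "xs \<in> permutations_of_set {1..n} \<and> weight xs = 0 \<and> blocks_of_perm xs = P"
    then have d: "distinct xs" and s: "set xs = {1..n}"
      by (auto simp: permutations_of_set_def)
    have "1 \<in> set xs" using s assms(1) by simp
    then obtain L' R' where eq: "xs = L' @ 1 # R'" by (meson split_list)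
    have notin: "1 \<notin> set L'" using d eq by auto
    have srt: "\<forall>b\<in>set (max_blocks L'). sorted b" "sorted R'"
      using weight_eq_0_iff xs eq by auto
    have P: "insert (insert 1 (set R')) (set ` set (max_blocks L')) = P"
      using xs notin eq by (simp add: blocks_of_perm_def)
    then have B': "insert 1 (set R') = B" using partition_on_eq_block[OF assms(2)] B by blast
    have "distinct R'" "1 \<notin> set R'" using d eq by auto
    then have "R' = R" using srt(2) R B' by (intro sorted_distinct_set_unique) auto
    have dL: "distinct L'" "set L' = {1..n} - B" using d s eq B' by auto
    \<comment> \<open>Blocks left of 1 do not contain 1, whereas \<open>B\<close> does; so
      \<open>P - {B}\<close> is exactly the set of blocks of \<open>L'\<close>.\<close>
    have "B \<notin> set ` set (max_blocks L')"
      using partition_on_max_blocks[OF dL(1)] notin B(2) by (auto simp: partition_on_def)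
    then have "good L'" unfolding good_def using P B' dL srt by auto
    then have "L' = L" using ex1 \<open>good L\<close> by blast
    then show "xs = L @ 1 # R" using eq \<open>R' = R\<close> by simp
  qed
qed

theorem theorem6p3:
  fixes n k :: nat
  assumes "n \<ge> 1" and "1 \<le> k" and "k \<le> n"
  shows "(\<exists>f. bij_betw f
             {xs \<in> permutations_of_set {1..n}. weight xs = 0 \<and> des xs = k - 1}
             {P. partition_on {1..n} P \<and> card P = k}) \<and>
         card {xs \<in> permutations_of_set {1..n}. weight xs = 0 \<and> des xs = k - 1} = Stirling n k"
proof -
  let ?X = "{xs \<in> permutations_of_set {1..n}. weight xs = 0 \<and> des xs = k - 1}"
  let ?Y = "{P. partition_on {1..n} P \<and> card P = k}"
  have bij: "bij_betw blocks_of_perm ?X ?Y"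
  proof (rule bij_betw_imageI)
    show "inj_on blocks_of_perm ?X"
      using ex1_perm_of_partition[OF assms(1)] weight_0_perm[OF assms(1)]
      by (intro inj_onI) blast
    show "blocks_of_perm ` ?X = ?Y"
    proof (intro equalityI subsetI)
      fix P assume "P \<in> blocks_of_perm ` ?X"
      \<comment> \<open>Since \<open>1 \<le> k\<close>, the truncated difference satisfies
        \<open>Suc (k - 1) = k\<close>.\<close>
      then show "P \<in> ?Y" using weight_0_perm[OF assms(1)] assms(2) by auto
    next
      fix P assume P: "P \<in> ?Y"
      then obtain xs where xs: "xs \<in> permutations_of_set {1..n}" "weight xs = 0"
        "blocks_of_perm xs = P" using ex1_perm_of_partition[OF assms(1)] by blast
      then have "des xs = k - 1" using weight_0_perm[OF assms(1) xs(1,2)] P by auto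
      then show "P \<in> blocks_of_perm ` ?X" using xs by blast
    qed
  qed
  then have "card ?X = Stirling n k"
    using bij_betw_same_card card_partitions_eq_Stirling[of "{1..n}" k] by fastforce
  with bij show ?thesis by blast
qed

end
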